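(* Let $U_1,\ldots,U_n$ be closed linear subspaces of a real Hilbert space $\mathcal H$, $A_i=N_{U_i}$ for $i=1,\ldots,n$, and $U=U_1\cap\cdots\cap U_n$. Let $G=(\mathcal N,\mathcal E)$ be an algorithmic graph of order $n\ge2$, $G'=(\mathcal N,\mathcal E')$ a connected spanning subgraph of $G$, and $Z\in\mathbb R^{n\times(n-1)}$ with $\operatorname{Lap}(G')=ZZ^*$. Let $\mathcal T=(\mathcal M+\mathcal A)^{-1}\mathcal M:\mathcal H^{2n-1}\to\mathcal H^{2n-1}$, $\boldsymbol\alpha=Z^\dagger\boldsymbol\delta\in\mathbb R^{n-1}$ and $E=Z_\otimes^\dagger(\mathcal U^\perp\cap\Delta_n^\perp)\subseteq\mathcal H^{n-1}$, as defined in the context. Then the $\mathcal M$-projection onto $\operatorname{Fix}\mathcal T$ is $$P^{\mathcal M}_{\operatorname{Fix}\mathcal T}=\begin{bmatrix}\mathbf 1_n \\ \boldsymbol\alpha\end{bmatrix}_\otimes P_U\,\boldsymbol\alpha_\otimes^\dagger\,\mathcal C^*+\begin{bmatrix}(\mathbf 0_{n\times(2n-1)})_\otimes \\ P_E\,\mathcal C^*\end{bmatrix}.$$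
   Context: $\mathcal H^m$ carries the inner product $\langle\boldsymbol x,\boldsymbol y\rangle=\sum_i\langle x_i,y_i\rangle$. $N_{U_i}(x)=U_i^\perp$ if $x\in U_i$ and $\emptyset$ otherwise (normal cone). $P_S$ is the orthogonal projection onto $S$. $\operatorname{Fix}T=\{x\mid T(x)=x\}$. For a self-adjoint positive semidefinite $\mathcal M$, $\|x\|_{\mathcal M}=\sqrt{\langle x,\mathcal Mx\rangle}$ (a seminorm) and the $\mathcal M$-projection $P_S^{\mathcal M}(u)$ of $u$ onto a set $S$ is the set of points of $S$ minimizing $\|u-s\|_{\mathcal M}$ over $s\in S$; for $S=\operatorname{Fix}\mathcal T$ it is single-valued and identified with its unique element. Graphs: an algorithmic graph of order $n\ge2$ is a directed graph $G=(\mathcal N,\mathcal E)$ with $\mathcal N=\{1,\ldots,n\}$, $\mathcal E\subseteq\mathcal N\times\mathcal N$, $(i,j)\in\mathcal E\Rightarrow i<j$, and $G$ connected (ignoring edge directions). $G'$ is a spanning subgraph of $G$ if $\mathcal E'\subseteq\mathcal E$. $d_i^{\rm in}=|\{j:(j,i)\in\mathcal E\}|$, $d_i^{\rm out}=|\{j:(i,j)\in\mathcal E\}|$, $d_i=d_i^{\rm in}+d_i^{\rm out}$ are the degrees in $G$. The Laplacian of a graph is the $n\times n$ matrix with the degrees of that graph on the diagonal, $-1$ in entry $(i,j)$ if $i,j$ are adjacent (i.e. $(i,j)$ or $(j,i)$ is an edge), and $0$ otherwise. The degree balance of $G$ is $\boldsymbol\delta\in\mathbb R^n$, $\delta_i=d_i^{\rm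 out}-d_i^{\rm in}$. Notation: for $K\in\mathbb R^{m\times p}$, $K_\otimes:\mathcal H^p\to\mathcal H^m$, $(K_\otimes\boldsymbol x)_i=\sum_jK_{i,j}x_j$; for $\boldsymbol\beta\in\mathbb R^m$, $\boldsymbol\beta_\otimes x=(\beta_1x,\ldots,\beta_mx)$. $\mathbf 1_n$ is the all-ones vector. $Z^\dagger$, $\boldsymbol\alpha^\dagger$ are Moore--Penrose inverses ($\boldsymbol\alpha\ne0$ and $\boldsymbol\alpha^\dagger=\boldsymbol\alpha^*/\|\boldsymbol\alpha\|^2$), $Z_\otimes^\dagger=(Z^\dagger)_\otimes$, and $\boldsymbol\alpha_\otimes^\dagger\boldsymbol v=\|\boldsymbol\alpha\|^{-2}\sum_j\alpha_jv_j$. $\Delta_n=\{(x,\ldots,x)\in\mathcal H^n\mid x\in\mathcal H\}$, $\mathcal U=U_1\times\cdots\times U_n\subseteq\mathcal H^n$. Operators: $\mathcal A_D(\boldsymbol x)=A_1(x_1)\times\cdots\times A_n(x_n)$ for $\boldsymbol x\in\mathcal H^n$. $P(G)\in\mathbb R^{n\times n}$ has entries $P(G)_{i,i}=d_i$, $P(G)_{i,j}=-2$ if $(j,i)\in\mathcal E$, and $0$ otherwise. On $\mathcal H^{2n-1}=\mathcal H^n\times\mathcal H^{n-1}$, $$\mathcal M=\begin{bmatrix}\operatorname{Lap}(G') & Z \\ Z^* & I_{n-1}\end{bmatrix}_\otimes,\quad \mathcal C=\begin{bmatrix} Z \\ I_{n-1}\end{bmatrix}_\otimes:\mathcal H^{n-1}\to\mathcal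 H^{2n-1},\quad \mathcal A=\begin{bmatrix}\mathcal A_D+P(G)_\otimes-\operatorname{Lap}(G')_\otimes & -Z_\otimes \\ Z^*_\otimes & 0\end{bmatrix}.$$ Thus $\mathcal C^*(\boldsymbol w,\boldsymbol v)=Z_\otimes^*\boldsymbol w+\boldsymbol v$. $(\mathcal M+\mathcal A)^{-1}$ is the inverse as a set-valued operator (it is single-valued with full domain). *)

theory Defs
  imports "HOL-Analysis.Analysis"
begin

text \<open>
  The nodes \<open>1 < \<dots> < n\<close> are the elements of an arbitrary finite linearly ordered type
  \<open>'n\<close> with \<open>n = CARD('n)\<close>; a type \<open>'m\<close> with \<open>CARD('m) = CARD('n) - 1\<close> indexes the remaining
  \<open>n - 1\<close> coordinates.  Thus \<open>\<H>\<^sup>n\<close> is \<open>'h^'n\<close>, \<open>\<H>\<^sup>n\<^sup>-\<^sup>1\<close> is \<open>'h^'m\<close> and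
  \<open>\<H>\<^sup>2\<^sup>n\<^sup>-\<^sup>1\<close> is \<open>('h^'n) \<times> ('h^'m)\<close>, with the library's inner products, which are the
  sums of the componentwise ones.
\<close>

subsection \<open>Graphs\<close>

definition graph_connected :: "('n \<times> 'n) set \<Rightarrow> bool" where
  "graph_connected E \<longleftrightarrow> (\<forall>i j. (i, j) \<in> (E \<union> E\<inverse>)\<^sup>*)"

definition algorithmic_graph :: "('n::{finite,linorder} \<times> 'n) set \<Rightarrow> bool" where
  "algorithmic_graph E \<longleftrightarrow>
     CARD('n) \<ge> 2 \<and> (\<forall>i j. (i, j) \<in> E \<longrightarrow> i < j) \<and> graph_connected E"

definition in_deg :: "('n \<times> 'n) set \<Rightarrow> 'n \<Rightarrow> nat" where
  "in_deg E i = card {j. (j, i) \<in> E}"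

definition out_deg :: "('n \<times> 'n) set \<Rightarrow> 'n \<Rightarrow> nat" where
  "out_deg E i = card {j. (i, j) \<in> E}"

definition deg :: "('n \<times> 'n) set \<Rightarrow> 'n \<Rightarrow> nat" where
  "deg E i = in_deg E i + out_deg E i"

definition Lap :: "('n::finite \<times> 'n) set \<Rightarrow> real^'n^'n" where
  "Lap E = (\<chi> i j. if i = j then real (deg E i)
                   else if (i, j) \<in> E \<or> (j, i) \<in> E then -1 else 0)"

definition degree_balance :: "('n::finite \<times> 'n) set \<Rightarrow> real^'n" where
  "degree_balance E = (\<chi> i. real (out_deg E i) - real (in_deg E i))"

definition PG :: "('n::finite \<times> 'n) set \<Rightarrow> real^'n^'n" where
  "PG E = (\<chi> i j. if i = j then real (deg E i) else if (j, i) \<in> E then -2 else 0)"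


subsection \<open>Matrices acting on products of the Hilbert space\<close>

definition mat_tensor :: "real^'p^'q \<Rightarrow> 'h::real_vector^'p \<Rightarrow> 'h^'q" where
  "mat_tensor K x = (\<chi> i. \<Sum>j\<in>UNIV. K $ i $ j *\<^sub>R x $ j)"

definition vec_tensor :: "real^'q \<Rightarrow> 'h::real_vector \<Rightarrow> 'h^'q" where
  "vec_tensor \<beta> x = (\<chi> i. \<beta> $ i *\<^sub>R x)"

text \<open>The operator of the row vector \<open>\<beta>\<^sup>\<dagger> = \<beta>\<^sup>* / \<parallel>\<beta>\<parallel>\<^sup>2\<close>, meant for \<open>\<beta> \<noteq> 0\<close>.\<close>

definition vec_pinv_tensor :: "real^'q \<Rightarrow> 'h::real_vector^'q \<Rightarrow> 'h" where
  "vec_pinv_tensor \<beta> v = (1 / (norm \<beta>)\<^sup>2) *\<^sub>R (\<Sum>j\<in>UNIV. \<beta> $ j *\<^sub>R v $ j)"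

text \<open>The Moore--Penrose inverse, characterised by the four Penrose equations.\<close>

definition is_pinv :: "real^'p^'q \<Rightarrow> real^'q^'p \<Rightarrow> bool" where
  "is_pinv K X \<longleftrightarrow> K ** X ** K = K \<and> X ** K ** X = X \<and>
     transpose (K ** X) = K ** X \<and> transpose (X ** K) = X ** K"

definition pinv :: "real^'p^'q \<Rightarrow> real^'q^'p" where
  "pinv K = (THE X. is_pinv K X)"


subsection \<open>Projections and normal cones\<close>

text \<open>Meant for closed subspaces; the library's \<open>closest_point\<close> needs a Heine--Borel space.\<close>

definition orth_proj :: "'h::real_inner set \<Rightarrow> 'h \<Rightarrow> 'h" where
  "orth_proj S x = (THE p. p \<in> S \<and> x - p \<in> S\<^sup>\<bottom>)"

definition normal_cone_subspace :: "'h::real_inner set \<Rightarrow> 'h \<Rightarrow> 'h set" where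
  "normal_cone_subspace S x = (if x \<in> S then S\<^sup>\<bottom> else {})"

definition op_seminorm :: "('x::real_inner \<Rightarrow> 'x) \<Rightarrow> 'x \<Rightarrow> real" where
  "op_seminorm M x = sqrt (x \<bullet> M x)"

definition op_proj :: "('x::real_inner \<Rightarrow> 'x) \<Rightarrow> 'x set \<Rightarrow> 'x \<Rightarrow> 'x set" where
  "op_proj M S u = {s \<in> S. \<forall>t\<in>S. op_seminorm M (u - s) \<le> op_seminorm M (u - t)}"

definition prod_set :: "('n::finite \<Rightarrow> 'h set) \<Rightarrow> ('h^'n) set" where
  "prod_set U = {x. \<forall>i. x $ i \<in> U i}"

definition diagonal :: "('h^'n::finite) set" where
  "diagonal = {x. \<exists>h. x = (\<chi> i. h)}"


subsection \<open>Operators\<close>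

text \<open>A set-valued operator is a set-valued function.\<close>

definition op_inverse :: "('x \<Rightarrow> 'y set) \<Rightarrow> 'y \<Rightarrow> 'x set" where
  "op_inverse B y = {x. y \<in> B x}"

text \<open>Fixed points of an operator whose values are singletons, identified with points.\<close>

definition Fix :: "('x \<Rightarrow> 'x set) \<Rightarrow> 'x set" where
  "Fix T = {x. T x = {x}}"

definition A_D :: "('n::finite \<Rightarrow> 'h \<Rightarrow> 'h set) \<Rightarrow> 'h^'n \<Rightarrow> ('h^'n) set" where
  "A_D A x = prod_set (\<lambda>i. A i (x $ i))"

definition M_op :: "('n::finite \<times> 'n) set \<Rightarrow> real^'m^'n
    \<Rightarrow> ('h::real_vector^'n) \<times> ('h^'m) \<Rightarrow> ('h^'n) \<times> ('h^'m)" where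
  "M_op E' Z = (\<lambda>(w, v). (mat_tensor (Lap E') w + mat_tensor Z v,
                          mat_tensor (transpose Z) w + mat_tensor (mat 1) v))"

definition C_op :: "real^'m^'n \<Rightarrow> 'h::real_vector^'m \<Rightarrow> ('h^'n) \<times> ('h^'m)" where
  "C_op Z v = (mat_tensor Z v, mat_tensor (mat 1) v)"

definition A_op :: "('n::finite \<Rightarrow> 'h \<Rightarrow> 'h set) \<Rightarrow> ('n \<times> 'n) set \<Rightarrow> ('n \<times> 'n) set
    \<Rightarrow> real^'m^'n \<Rightarrow> ('h::real_vector^'n) \<times> ('h^'m) \<Rightarrow> (('h^'n) \<times> ('h^'m)) set" where
  "A_op A E E' Z = (\<lambda>(w, v).
     {(a + mat_tensor (PG E) w - mat_tensor (Lap E') w - mat_tensor Z v,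
       mat_tensor (transpose Z) w) | a. a \<in> A_D A w})"

definition T_op :: "('n::finite \<Rightarrow> 'h \<Rightarrow> 'h set) \<Rightarrow> ('n \<times> 'n) set \<Rightarrow> ('n \<times> 'n) set
    \<Rightarrow> real^'m^'n \<Rightarrow> ('h::real_vector^'n) \<times> ('h^'m) \<Rightarrow> (('h^'n) \<times> ('h^'m)) set" where
  "T_op A E E' Z u =
     op_inverse (\<lambda>x. {M_op E' Z x + y | y. y \<in> A_op A E E' Z x}) (M_op E' Z u)"

end

theory Submission
  imports Defs
begin

text \<open>
  As \<open>\<M> + \<A>\<close> has a single-valued inverse, the fixed points of \<open>T\<close> are the zeros \<open>(w, v)\<close>
  of \<open>\<A>\<close> (\<open>Fix_T_op_eq_zeros\<close>), and these can be written down.  The kernel of \<open>Z\<^sup>*\<close> is that of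
  \<open>Lap G' = Z Z\<^sup>*\<close>, the diagonal, so \<open>w = (h, \<dots>, h)\<close> with \<open>h \<in> U\<close>.  On the diagonal \<open>P(G)\<close>
  acts as the degree balance \<open>\<delta>\<close>, so what remains is \<open>Z v - \<delta> h \<in> \<U>\<^sup>\<bottom>\<close>.  As \<open>\<delta>\<close> has entry
  sum zero, \<open>\<delta> = Z \<alpha>\<close>, and the condition says \<open>v - \<alpha> h \<in> E\<close>.  Thus the fixed points are
  the \<open>(\<one> h, \<alpha> h + e)\<close> with \<open>h \<in> U\<close> and \<open>e \<in> E\<close> (\<open>zeros_A_op\<close>).

  On the other hand \<open>\<M> = \<C> \<C>\<^sup>*\<close>, so the \<open>\<M>\<close>-projection of \<open>u\<close> is the nearest-point problem for
  \<open>\<C>\<^sup>* u\<close> in the image of the fixed points under \<open>\<C>\<^sup>*\<close> (\<open>op_proj_eqI\<close>).  On fixed points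
  \<open>\<C>\<^sup>*\<close> returns the second component, and the spaces \<open>\<alpha> U\<close> and \<open>E\<close> are orthogonal to each
  other.  So the two parts are projected separately: onto \<open>\<alpha> U\<close> by \<open>\<alpha> P\<^sub>U \<alpha>\<^sup>\<dagger>\<close>
  (\<open>vec_pinv_tensor_orthogonal\<close>), which uses \<open>\<alpha> \<noteq> 0\<close> and hence \<open>\<delta> \<noteq> 0\<close>, and onto \<open>E\<close> by
  \<open>P\<^sub>E\<close>.
\<close>

section \<open>Orthogonal projections in a Hilbert space\<close>

lemma closed_orthogonal_comp: "closed (S\<^sup>\<bottom>)"
proof -
  have "S\<^sup>\<bottom> = (\<Inter>y\<in>S. {x. y \<bullet> x = 0})"
    by (auto simp: orthogonal_comp_def orthogonal_def)
  then show ?thesis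
    by (auto intro!: closed_INT closed_Collect_eq continuous_intros)
qed

lemma parallelogram_law:
  fixes a b :: "'a::real_inner"
  shows "(norm (a - b))\<^sup>2 + (norm (a + b))\<^sup>2 = 2 * (norm a)\<^sup>2 + 2 * (norm b)\<^sup>2"
  by (simp add: power2_norm_eq_inner inner_add_left inner_add_right inner_diff_left inner_diff_right)

text \<open>
  By the parallelogram law, the points of \<open>S\<close> that almost attain the distance from \<open>x\<close> lie close
  together; so completeness provides a point that attains it.
\<close>

lemma nearest_point_exists:
  fixes S :: "'a::{real_inner,complete_space} set"
  assumes S: "subspace S" "closed S"
  obtains p where "p \<in> S" "\<And>y. y \<in> S \<Longrightarrow> norm (x - p) \<le> norm (x - y)"
proof -
  define d where "d = (INF y\<in>S. (norm (x - y))\<^sup>2)"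
  define N where "N n = {y \<in> S. (norm (x - y))\<^sup>2 \<le> d + inverse (real (Suc n))}" for n
  have bdd: "bdd_below ((\<lambda>y. (norm (x - y))\<^sup>2) ` S)"
    by (auto intro!: bdd_belowI[of _ 0])
  have d: "d \<le> (norm (x - y))\<^sup>2" if "y \<in> S" for y
    unfolding d_def by (rule cINF_lower[OF bdd that])
  have ne: "S \<noteq> {}" using subspace_0[OF S(1)] by blast
  have N_closed: "closed (N n)" for n
  proof -
    have "N n = S \<inter> {y. (norm (x - y))\<^sup>2 \<le> d + inverse (real (Suc n))}"
      by (auto simp: N_def)
    then show ?thesis
      using S(2) by (auto intro!: closed_Int closed_Collect_le continuous_intros)
  qed
  have N_nonempty: "N n \<noteq> {}" for n
  proof -
    have "\<exists>y\<in>S. (norm (x - y))\<^sup>2 < d + inverse (real (Suc n))"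
      using cINF_less_iff[OF ne bdd, of "d + inverse (real (Suc n))"]
      by (simp add: d_def)
    then show ?thesis by (force simp: N_def)
  qed
  have N_decreasing: "N n \<subseteq> N m" if "m \<le> n" for m n
  proof -
    have "inverse (real (Suc n)) \<le> inverse (real (Suc m))"
      using that by (simp add: field_simps)
    then show ?thesis
      unfolding N_def by (intro Collect_mono impI conjI; elim conjE; (assumption | linarith))
  qed
  have N_small: "\<exists>n. \<forall>y\<in>N n. \<forall>z\<in>N n. dist y z < e" if e: "e > 0" for e
  proof -
    obtain n where n: "inverse (real (Suc n)) < e\<^sup>2 / 4"
      using reals_Archimedean[of "e\<^sup>2 / 4"] e by (auto simp del: of_nat_Suc)
    have "dist y z < e" if y: "y \<in> N n" and z: "z \<in> N n" for y z
    proof -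
      define h where "h = (1/2) *\<^sub>R (y + z)"
      have "h \<in> S"
        using y z S(1) by (auto simp: N_def h_def intro!: subspace_scale subspace_add)
      have "2 *\<^sub>R (x - h) = (x - y) + (x - z)"
        by (simp add: h_def scaleR_diff_right scaleR_2)
      from arg_cong[OF this, of norm]
      have "4 * (norm (x - h))\<^sup>2 = (norm ((x - y) + (x - z)))\<^sup>2"
        by (metis norm_scaleR abs_numeral power_mult_distrib four_x_squared mult_2)
      moreover have "norm (y - z) = norm ((x - y) - (x - z))"
        by (simp add: norm_minus_commute[of y z])
      ultimately have "(norm (y - z))\<^sup>2 + 4 * (norm (x - h))\<^sup>2 =
          2 * (norm (x - y))\<^sup>2 + 2 * (norm (x - z))\<^sup>2"
        using parallelogram_law[of "x - y" "x - z"] by simp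
      also have "\<dots> \<le> 4 * d + 4 * inverse (real (Suc n))"
        using y z by (auto simp: N_def)
      finally have "(norm (y - z))\<^sup>2 < e\<^sup>2"
        using d[OF \<open>h \<in> S\<close>] n by linarith
      then show ?thesis
        using e by (simp add: dist_norm power2_less_imp_less)
    qed
    then show ?thesis by blast
  qed
  obtain p where p: "\<And>n. p \<in> N n"
    using decreasing_closed_nest[OF N_closed N_nonempty N_decreasing N_small] by metis
  have le: "(norm (x - p))\<^sup>2 \<le> d"
  proof (rule field_le_epsilon)
    fix e :: real assume "e > 0"
    obtain n where "inverse (real (Suc n)) < e" using reals_Archimedean[OF \<open>e > 0\<close>] ..
    moreover have "(norm (x - p))\<^sup>2 \<le> d + inverse (real (Suc n))" using p[of n] by (simp add: N_def)
    ultimately show "(norm (x - p))\<^sup>2 \<le> d + e" by linarith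
  qed
  have "norm (x - p) \<le> norm (x - y)" if "y \<in> S" for y
    by (rule power2_le_imp_le[OF order_trans[OF le d[OF that]] norm_ge_zero])
  moreover have "p \<in> S" using p[of 0] by (simp add: N_def)
  ultimately show thesis by (rule that[rotated])
qed

lemma orth_proj_unique:
  assumes "subspace S" "p \<in> S" "x - p \<in> S\<^sup>\<bottom>" "q \<in> S" "x - q \<in> S\<^sup>\<bottom>"
  shows "q = p"
proof -
  have "p - q \<in> S" using assms by (simp add: subspace_diff)
  then have "(p - q) \<bullet> (x - q) - (p - q) \<bullet> (x - p) = 0"
    using assms(3,5) by (simp add: orthogonal_comp_def orthogonal_def)
  then have "(p - q) \<bullet> (p - q) = 0" by (simp add: inner_diff_right)
  then show ?thesis by simp
qed

text \<open>
  The residual at a nearest point \<open>p\<close> is orthogonal to \<open>S\<close>: otherwise moving \<open>p\<close> along some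
  \<open>y \<in> S\<close> would decrease the distance.
\<close>

lemma orth_proj:
  fixes S :: "'a::{real_inner,complete_space} set"
  assumes S: "subspace S" "closed S"
  shows "orth_proj S x \<in> S" "x - orth_proj S x \<in> S\<^sup>\<bottom>"
proof -
  obtain p where p: "p \<in> S" and min: "\<And>y. y \<in> S \<Longrightarrow> norm (x - p) \<le> norm (x - y)"
    using nearest_point_exists[OF S] by blast
  have "y \<bullet> (x - p) = 0" if "y \<in> S" for y
  proof (rule ccontr)
    assume *: "y \<bullet> (x - p) \<noteq> 0"
    then have "y \<noteq> 0" by auto
    then have y: "y \<bullet> y > 0" by simp
    define t where "t = (y \<bullet> (x - p)) / (y \<bullet> y)"
    have "norm (x - p) \<le> norm (x - (p + t *\<^sub>R y))"
      using p that S(1) by (intro min) (auto intro!: subspace_add subspace_scale)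
    then have "(x - p) \<bullet> (x - p) \<le> ((x - p) - t *\<^sub>R y) \<bullet> ((x - p) - t *\<^sub>R y)"
      by (simp add: norm_le diff_diff_eq)
    also have "\<dots> = (x - p) \<bullet> (x - p) - 2 * t * (y \<bullet> (x - p)) + t * (t * (y \<bullet> y))"
    proof -
      have "(r - t *\<^sub>R y) \<bullet> (r - t *\<^sub>R y) = r \<bullet> r - 2 * t * (y \<bullet> r) + t * (t * (y \<bullet> y))" for r
        by (simp add: inner_diff_left inner_diff_right inner_commute[of r y] right_diff_distrib)
      then show ?thesis .
    qed
    also have "t * (y \<bullet> y) = y \<bullet> (x - p)"
      using y by (simp add: t_def)
    finally have "t * (y \<bullet> (x - p)) \<le> 0" by simp
    moreover have "t * (y \<bullet> (x - p)) = (y \<bullet> (x - p))\<^sup>2 / (y \<bullet> y)"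
      by (simp add: t_def power2_eq_square)
    moreover have "\<dots> > 0" using * y by simp
    ultimately show False by simp
  qed
  then have *: "p \<in> S \<and> x - p \<in> S\<^sup>\<bottom>"
    using p by (simp add: orthogonal_comp_def orthogonal_def)
  have "q = p" if "q \<in> S \<and> x - q \<in> S\<^sup>\<bottom>" for q
    using orth_proj_unique[OF S(1), of p x q] * that by simp
  with * have "orth_proj S x \<in> S \<and> x - orth_proj S x \<in> S\<^sup>\<bottom>"
    unfolding orth_proj_def by (rule theI)
  then show "orth_proj S x \<in> S" "x - orth_proj S x \<in> S\<^sup>\<bottom>" by auto
qed

text \<open>
  If \<open>M = L\<^sup>* L\<close>, then the seminorm of \<open>M\<close> is the norm after \<open>L\<close>, and an \<open>M\<close>-projection is a
  nearest point in the image under \<open>L\<close>.  Orthogonality of the residual and Pythagoras give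
  minimality; injectivity of \<open>L\<close> on \<open>F\<close> gives uniqueness, although the seminorm is degenerate.
\<close>

lemma op_proj_eqI:
  assumes M: "\<And>x. x \<bullet> M x = L x \<bullet> L x" and L: "\<And>x y. L (x - y) = L x - L y"
    and s: "s \<in> F" and orth: "\<And>t. t \<in> F \<Longrightarrow> (L u - L s) \<bullet> (L s - L t) = 0"
    and inj: "inj_on L F"
  shows "op_proj M F u = {s}"
proof -
  have sn: "op_seminorm M x = norm (L x)" for x
    by (simp add: op_seminorm_def M norm_eq_sqrt_inner)
  have pyth: "(norm (L (u - t)))\<^sup>2 = (norm (L (u - s)))\<^sup>2 + (norm (L s - L t))\<^sup>2" if "t \<in> F" for t
  proof -
    have "L (u - t) = (L u - L s) + (L s - L t)" by (simp add: L)
    then show ?thesis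
      using norm_add_Pythagorean[of "L u - L s" "L s - L t"] orth[OF that]
      by (simp add: orthogonal_def L)
  qed
  have "norm (L (u - s)) \<le> norm (L (u - t))" if "t \<in> F" for t
    by (rule power2_le_imp_le) (simp_all add: pyth[OF that])
  then have "s \<in> op_proj M F u" using s by (simp add: op_proj_def sn)
  moreover have "t = s" if "t \<in> F" and le: "norm (L (u - t)) \<le> norm (L (u - s))" for t
  proof -
    have "(norm (L (u - t)))\<^sup>2 \<le> (norm (L (u - s)))\<^sup>2"
      using le by (simp add: power_mono)
    then have "L t = L s" using pyth[OF that(1)] by simp
    then show ?thesis by (rule inj_onD[OF inj _ that(1) s])
  qed
  then have "op_proj M F u \<subseteq> {s}" using s unfolding op_proj_def sn by blast
  ultimately show ?thesis by blast
qed


section \<open>Matrices acting on powers of the Hilbert space\<close>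

lemma mat_tensor_nth: "mat_tensor K x $ i = (\<Sum>j\<in>UNIV. K $ i $ j *\<^sub>R x $ j)"
  by (simp add: mat_tensor_def)

lemma vec_tensor_nth [simp]: "vec_tensor \<beta> h $ i = \<beta> $ i *\<^sub>R h"
  by (simp add: vec_tensor_def)

lemma mat_tensor_diff: "mat_tensor K (x - y) = mat_tensor K x - mat_tensor K y"
  by (simp add: vec_eq_iff mat_tensor_nth scaleR_diff_right sum_subtractf)

lemma mat_tensor_zero [simp]: "mat_tensor K 0 = 0"
  by (simp add: vec_eq_iff mat_tensor_nth)

lemma mat_tensor_mat_1 [simp]: "mat_tensor (mat 1) x = x"
  by (simp add: vec_eq_iff mat_tensor_nth mat_def if_distrib[of "\<lambda>c. c *\<^sub>R _"] cong: if_cong)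

lemma mat_tensor_mult: "mat_tensor K (mat_tensor L x) = mat_tensor (K ** L) x"
proof -
  have "(\<Sum>j\<in>UNIV. K $ i $ j *\<^sub>R (\<Sum>k\<in>UNIV. L $ j $ k *\<^sub>R x $ k)) =
        (\<Sum>k\<in>UNIV. (\<Sum>j\<in>UNIV. K $ i $ j * L $ j $ k) *\<^sub>R x $ k)" for i
    unfolding scaleR_sum_left scaleR_sum_right by (subst sum.swap) simp
  then show ?thesis
    by (simp add: vec_eq_iff mat_tensor_nth matrix_matrix_mult_def)
qed

lemma mat_tensor_vec_tensor: "mat_tensor K (vec_tensor \<beta> h) = vec_tensor (K *v \<beta>) h"
  by (simp add: vec_eq_iff mat_tensor_nth matrix_vector_mult_def scaleR_sum_left)

lemma mat_tensor_real: "mat_tensor K (x :: real^'p) = K *v x"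
  by (simp add: vec_eq_iff mat_tensor_nth matrix_vector_mult_def)

lemma inner_mat_tensor:
  fixes x :: "'h::real_inner^'q" and y :: "'h^'p"
  shows "x \<bullet> mat_tensor K y = mat_tensor (transpose K) x \<bullet> y"
proof -
  have "x \<bullet> mat_tensor K y = (\<Sum>i\<in>UNIV. \<Sum>j\<in>UNIV. K $ i $ j * (x $ i \<bullet> y $ j))"
    by (simp add: inner_vec_def mat_tensor_nth inner_sum_right)
  also have "\<dots> = (\<Sum>j\<in>UNIV. \<Sum>i\<in>UNIV. K $ i $ j * (x $ i \<bullet> y $ j))"
    by (rule sum.swap)
  also have "\<dots> = mat_tensor (transpose K) x \<bullet> y"
    by (simp add: inner_vec_def mat_tensor_nth inner_sum_left transpose_def)
  finally show ?thesis .
qed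

lemma inner_vec_tensor:
  fixes v :: "'h::real_inner^'q"
  shows "v \<bullet> vec_tensor \<beta> h = (\<Sum>j\<in>UNIV. \<beta> $ j *\<^sub>R v $ j) \<bullet> h"
  by (simp add: inner_vec_def inner_sum_left)

lemma vec_tensor_diff: "vec_tensor \<beta> (g - h) = vec_tensor \<beta> g - vec_tensor \<beta> h"
  by (simp add: vec_eq_iff scaleR_diff_right)

text \<open>
  For \<open>\<beta> \<noteq> 0\<close> the operator \<open>\<beta>\<^sup>\<dagger>\<close> sends \<open>v\<close> to the \<open>h\<close> for which \<open>\<beta> h\<close> is the orthogonal projection of \<open>v\<close>
  onto the vectors of this form.  So testing \<open>v - \<beta> p\<close> against such vectors reduces to testing
  \<open>\<beta>\<^sup>\<dagger> v - p\<close>, which leads from projections onto \<open>\<beta> U\<close> to projections onto \<open>U\<close>.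
\<close>

lemma vec_pinv_tensor_orthogonal:
  fixes v :: "'h::real_inner^'q"
  assumes "\<beta> \<noteq> 0"
  shows "(v - vec_tensor \<beta> p) \<bullet> vec_tensor \<beta> h = (norm \<beta>)\<^sup>2 * ((vec_pinv_tensor \<beta> v - p) \<bullet> h)"
proof -
  have "vec_tensor \<beta> p \<bullet> vec_tensor \<beta> h = (norm \<beta>)\<^sup>2 * (p \<bullet> h)"
    unfolding power2_norm_eq_inner
    by (simp add: inner_vec_def sum_distrib_right mult.assoc)
  moreover have "v \<bullet> vec_tensor \<beta> h = (norm \<beta>)\<^sup>2 * (vec_pinv_tensor \<beta> v \<bullet> h)"
    using assms by (simp add: inner_vec_tensor vec_pinv_tensor_def)
  ultimately show ?thesis
    by (simp add: inner_diff_left right_diff_distrib)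
qed

lemma diagonal_iff: "x \<in> diagonal \<longleftrightarrow> (\<exists>h. x = vec_tensor 1 h)"
  by (simp add: diagonal_def vec_tensor_def)

lemma diagonal_iff_eq: "x \<in> diagonal \<longleftrightarrow> (\<forall>i j. x $ i = x $ j)"
  by (auto simp: diagonal_def vec_eq_iff)

lemma orthogonal_comp_prod_set:
  assumes "\<And>i. 0 \<in> U i"
  shows "(prod_set U)\<^sup>\<bottom> = prod_set (\<lambda>i. (U i)\<^sup>\<bottom>)"
proof (intro equalityI subsetI)
  fix x assume x: "x \<in> (prod_set U)\<^sup>\<bottom>"
  have "h \<bullet> x $ i = 0" if "h \<in> U i" for i h
  proof -
    have "axis i h \<in> prod_set U" using that assms by (auto simp: prod_set_def axis_def)
    then have "axis i h \<bullet> x = 0"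
      using x by (simp add: orthogonal_comp_def orthogonal_def)
    then show ?thesis by (metis inner_axis inner_commute)
  qed
  then show "x \<in> prod_set (\<lambda>i. (U i)\<^sup>\<bottom>)"
    by (simp add: prod_set_def orthogonal_comp_def orthogonal_def)
next
  fix x assume "x \<in> prod_set (\<lambda>i. (U i)\<^sup>\<bottom>)"
  then show "x \<in> (prod_set U)\<^sup>\<bottom>"
    by (simp add: prod_set_def orthogonal_comp_def orthogonal_def inner_vec_def)
qed


section \<open>Moore--Penrose inverses\<close>

lemma is_pinv_unique:
  assumes X: "is_pinv K X" and Y: "is_pinv K Y"
  shows "X = Y"
proof -
  have "transpose (K ** X) = transpose ((K ** Y) ** (K ** X))"
    using Y by (simp add: is_pinv_def matrix_mul_assoc)
  also have "\<dots> = (K ** X) ** (K ** Y)"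
    using X Y by (simp add: is_pinv_def matrix_transpose_mul)
  also have "\<dots> = K ** Y"
    using X by (simp add: is_pinv_def matrix_mul_assoc)
  finally have KX: "K ** X = K ** Y"
    using X by (simp add: is_pinv_def)
  have "transpose (Y ** K) = transpose ((Y ** K) ** (X ** K))"
    using X by (simp add: is_pinv_def flip: matrix_mul_assoc)
  also have "\<dots> = (X ** K) ** (Y ** K)"
    using X Y by (simp add: is_pinv_def matrix_transpose_mul)
  also have "\<dots> = X ** K"
    using Y by (simp add: is_pinv_def flip: matrix_mul_assoc)
  finally have XK: "Y ** K = X ** K"
    using Y by (simp add: is_pinv_def)
  have "X = X ** (K ** X)" using X by (simp add: is_pinv_def matrix_mul_assoc)
  also have "\<dots> = Y ** K ** Y" by (simp add: KX XK matrix_mul_assoc)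
  also have "\<dots> = Y" using Y by (simp add: is_pinv_def)
  finally show ?thesis .
qed

text \<open>
  For injective \<open>K\<close> the Gram matrix \<open>K\<^sup>* K\<close> is invertible, and the Moore--Penrose inverse is
  \<open>(K\<^sup>* K)\<^sup>-\<^sup>1 K\<^sup>*\<close>.
\<close>

lemma pinv_injective:
  fixes K :: "real^'p^'q"
  assumes inj: "inj ((*v) K)"
  shows "is_pinv K (pinv K)" "pinv K ** K = mat 1"
proof -
  define G where "G = transpose K ** K"
  have "x = 0" if "G *v x = 0" for x
  proof -
    have "(K *v x) \<bullet> (K *v x) = (G *v x) \<bullet> x"
      unfolding G_def by (metis dot_lmul_matrix matrix_vector_mul_assoc transpose_matrix_vector)
    then have "K *v x = K *v 0" using that by simp
    then show ?thesis using inj by (metis injD)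
  qed
  then obtain B where BG: "B ** G = mat 1"
    using matrix_left_invertible_ker[of G] by blast
  then have GB: "G ** B = mat 1" by (simp add: matrix_left_right_inverse)
  have symG: "transpose G = G" by (simp add: G_def matrix_transpose_mul)
  have "transpose B ** G = mat 1"
    using arg_cong[OF GB, of transpose] by (simp add: matrix_transpose_mul symG)
  then have symB: "transpose B = B"
    by (metis GB matrix_mul_assoc matrix_mul_lid matrix_mul_rid)
  define X where "X = B ** transpose K"
  have XK: "X ** K = mat 1" using BG by (simp add: X_def G_def flip: matrix_mul_assoc)
  have "transpose (K ** X) = K ** X"
    by (simp add: X_def matrix_transpose_mul symB matrix_mul_assoc)
  then have X: "is_pinv K X"
    using XK by (simp add: is_pinv_def transpose_mat flip: matrix_mul_assoc)
  have "pinv K = X"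
    unfolding pinv_def by (rule the_equality) (auto intro: X is_pinv_unique)
  then show "is_pinv K (pinv K)" "pinv K ** K = mat 1" using X XK by auto
qed


section \<open>Degrees and the graph Laplacian\<close>

lemma in_deg_sum: "real (in_deg E i) = (\<Sum>j\<in>UNIV. of_bool ((j, i) \<in> E))"
  for E :: "('n::finite \<times> 'n) set"
  by (simp add: in_deg_def of_bool_def sum.If_cases)

lemma out_deg_sum: "real (out_deg E i) = (\<Sum>j\<in>UNIV. of_bool ((i, j) \<in> E))"
  for E :: "('n::finite \<times> 'n) set"
  by (simp add: out_deg_def of_bool_def sum.If_cases)

lemma mat_tensor_Lap_nth:
  fixes E :: "('n::finite \<times> 'n) set" and w :: "'h::real_vector^'n"
  assumes asym: "\<And>i j. (i, j) \<in> E \<Longrightarrow> (j, i) \<notin> E"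
  shows "mat_tensor (Lap E) w $ i =
    (\<Sum>j\<in>UNIV. (of_bool ((i, j) \<in> E) + of_bool ((j, i) \<in> E)) *\<^sub>R (w $ i - w $ j))"
proof -
  have "Lap E $ i $ j = (if j = i then real (deg E i) else 0)
      - (of_bool ((i, j) \<in> E) + of_bool ((j, i) \<in> E))" for j
    using asym by (auto simp: Lap_def)
  then have "mat_tensor (Lap E) w $ i = real (deg E i) *\<^sub>R w $ i
      - (\<Sum>j\<in>UNIV. (of_bool ((i, j) \<in> E) + of_bool ((j, i) \<in> E)) *\<^sub>R w $ j)"
    by (simp add: mat_tensor_nth scaleR_diff_left sum_subtractf
        if_distrib[of "\<lambda>c. c *\<^sub>R _"] cong: if_cong)
  also have "real (deg E i) = (\<Sum>j\<in>UNIV. of_bool ((i, j) \<in> E) + of_bool ((j, i) \<in> E))"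
    by (simp add: deg_def in_deg_sum out_deg_sum sum.distrib)
  finally show ?thesis
    by (simp add: scaleR_sum_left scaleR_diff_right sum_subtractf)
qed

text \<open>
  Entry \<open>i\<close> of the Laplacian sums \<open>w\<^sub>i - w\<^sub>j\<close> over the neighbours \<open>j\<close>; in the inner product with
  \<open>w\<close>, the contributions of an edge at its two ends add up to a square.
\<close>

lemma Lap_quadratic_form:
  fixes E :: "('n::finite \<times> 'n) set" and w :: "'h::real_inner^'n"
  assumes asym: "\<And>i j. (i, j) \<in> E \<Longrightarrow> (j, i) \<notin> E"
  shows "w \<bullet> mat_tensor (Lap E) w =
    (\<Sum>i\<in>UNIV. \<Sum>j\<in>UNIV. of_bool ((i, j) \<in> E) * (norm (w $ i - w $ j))\<^sup>2)"
proof -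
  let ?e = "\<lambda>i j. of_bool ((i, j) \<in> E) :: real"
  have "w \<bullet> mat_tensor (Lap E) w =
      (\<Sum>i\<in>UNIV. \<Sum>j\<in>UNIV. (?e i j + ?e j i) * (w $ i \<bullet> (w $ i - w $ j)))"
    by (simp add: inner_vec_def mat_tensor_Lap_nth[OF asym] inner_sum_right)
  also have "\<dots> = (\<Sum>i\<in>UNIV. \<Sum>j\<in>UNIV. ?e i j * (w $ i \<bullet> (w $ i - w $ j)))
      + (\<Sum>i\<in>UNIV. \<Sum>j\<in>UNIV. ?e j i * (w $ i \<bullet> (w $ i - w $ j)))"
    by (simp add: distrib_right sum.distrib)
  also have "(\<Sum>i\<in>UNIV. \<Sum>j\<in>UNIV. ?e j i * (w $ i \<bullet> (w $ i - w $ j))) =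
      (\<Sum>i\<in>UNIV. \<Sum>j\<in>UNIV. ?e i j * (w $ j \<bullet> (w $ j - w $ i)))"
    by (rule sum.swap)
  finally show ?thesis
    unfolding power2_norm_eq_inner
    by (simp add: algebra_simps inner_diff_left inner_diff_right inner_commute
        flip: sum.distrib)
qed

text \<open>
  Along each edge a vector in the kernel has equal entries, because its quadratic form is a sum of
  squares; connectedness then makes all of them equal.
\<close>

lemma Lap_kernel_diagonal:
  fixes E :: "('n::finite \<times> 'n) set" and w :: "'h::real_inner^'n"
  assumes asym: "\<And>i j. (i, j) \<in> E \<Longrightarrow> (j, i) \<notin> E"
    and conn: "graph_connected E" and w: "mat_tensor (Lap E) w = 0"
  shows "w \<in> diagonal"
proof -
  have "(\<Sum>i\<in>UNIV. \<Sum>j\<in>UNIV. of_bool ((i, j) \<in> E) * (norm (w $ i - w $ j))\<^sup>2) = 0"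
    using Lap_quadratic_form[OF asym, of w] w by simp
  then have "of_bool ((i, j) \<in> E) * (norm (w $ i - w $ j))\<^sup>2 = 0" for i j
    by (simp add: sum_nonneg_eq_0_iff sum_nonneg)
  then have edge: "w $ i = w $ j" if "(i, j) \<in> E" for i j
    using \<open>of_bool ((i, j) \<in> E) * (norm (w $ i - w $ j))\<^sup>2 = 0\<close> that by simp
  have "w $ i = w $ j" if "(i, j) \<in> (E \<union> E\<inverse>)\<^sup>*" for i j
    using that by induction (auto dest: edge)
  then show ?thesis using conn by (simp add: graph_connected_def diagonal_iff_eq)
qed

lemma mat_tensor_Lap_diagonal:
  assumes asym: "\<And>i j. (i, j) \<in> E \<Longrightarrow> (j, i) \<notin> E" and w: "w \<in> diagonal"
  shows "mat_tensor (Lap E) w = 0"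
proof -
  have eq: "w $ i - w $ j = 0" for i j using w by (simp add: diagonal_iff_eq)
  show ?thesis by (simp add: vec_eq_iff mat_tensor_Lap_nth[OF asym] eq)
qed

lemma degree_balance_orthogonal_diagonal:
  fixes h :: "'h::real_inner"
  shows "vec_tensor (degree_balance E) h \<in> diagonal\<^sup>\<bottom>"
proof -
  have "(\<Sum>i\<in>UNIV. degree_balance E $ i) = 0"
    using sum.swap[of "\<lambda>i j. of_bool ((i, j) \<in> E) :: real" UNIV UNIV]
    by (simp add: degree_balance_def in_deg_sum out_deg_sum sum_subtractf)
  then show ?thesis
    by (auto simp: diagonal_iff orthogonal_comp_def orthogonal_def inner_vec_def
        simp flip: sum_distrib_right)
qed

lemma incident_edge:
  assumes G: "algorithmic_graph (G :: ('n::{finite,linorder} \<times> 'n) set)"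
  obtains j where "(i, j) \<in> G \<or> (j, i) \<in> G"
proof -
  have "CARD('n) \<ge> 2" and conn: "graph_connected G"
    using G by (auto simp: algorithmic_graph_def)
  have "\<exists>j. j \<noteq> i"
  proof (rule ccontr)
    assume "\<nexists>j. j \<noteq> i"
    then have "(UNIV :: 'n set) = {i}" by auto
    then have "CARD('n) = card {i}" by (rule arg_cong)
    then show False using \<open>CARD('n) \<ge> 2\<close> by simp
  qed
  then obtain k where "k \<noteq> i" ..
  moreover have "(i, k) \<in> (G \<union> G\<inverse>)\<^sup>*" using conn by (simp add: graph_connected_def)
  ultimately obtain j where "(i, j) \<in> G \<union> G\<inverse>"
    by (metis converse_rtranclE)
  then show thesis by (intro that[of j]) auto
qed

lemma deg_pos:
  assumes "algorithmic_graph G"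
  shows "deg G i > 0"
proof -
  obtain j where "(i, j) \<in> G \<or> (j, i) \<in> G" using incident_edge[OF assms] .
  then have "{j. (i, j) \<in> G} \<noteq> {} \<or> {j. (j, i) \<in> G} \<noteq> {}" by auto
  then show ?thesis by (auto simp: deg_def in_deg_def out_deg_def card_gt_0_iff)
qed

text \<open>The first node has no incoming edge, so its balance is its degree.\<close>

lemma degree_balance_nonzero:
  assumes G: "algorithmic_graph (G :: ('n::{finite,linorder} \<times> 'n) set)"
  shows "degree_balance G \<noteq> 0"
proof -
  define i where "i = Min (UNIV :: 'n set)"
  have min: "i \<le> j" for j by (simp add: i_def)
  have less: "\<And>i j. (i, j) \<in> G \<Longrightarrow> i < j" using G by (auto simp: algorithmic_graph_def)
  have "(j, i) \<notin> G" for j using less[of j i] min[of j] by auto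
  then have "in_deg G i = 0" by (simp add: in_deg_def)
  then have "degree_balance G $ i \<noteq> 0"
    using deg_pos[OF G, of i] by (simp add: degree_balance_def deg_def)
  then show ?thesis by auto
qed

lemma mat_tensor_PG_nth:
  assumes "\<And>i. (i, i) \<notin> E"
  shows "mat_tensor (PG E) w $ i =
    real (deg E i) *\<^sub>R w $ i - 2 *\<^sub>R (\<Sum>j\<in>UNIV. of_bool ((j, i) \<in> E) *\<^sub>R w $ j)"
proof -
  have "PG E $ i $ j = (if j = i then real (deg E i) else 0) - 2 * of_bool ((j, i) \<in> E)" for j
    using assms by (auto simp: PG_def)
  then show ?thesis
    by (simp add: mat_tensor_nth scaleR_diff_left sum_subtractf scaleR_sum_right
        if_distrib[of "\<lambda>c. c *\<^sub>R _"] cong: if_cong)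
qed

text \<open>Row \<open>i\<close> of \<open>P(G)\<close> has the sum \<open>d\<^sub>i - 2 d\<^sub>i\<^sup>i\<^sup>n = d\<^sub>i\<^sup>o\<^sup>u\<^sup>t - d\<^sub>i\<^sup>i\<^sup>n\<close>.\<close>

lemma mat_tensor_PG_diagonal:
  assumes "\<And>i. (i, i) \<notin> E"
  shows "mat_tensor (PG E) (vec_tensor 1 h) = vec_tensor (degree_balance E) h"
proof -
  have "(\<Sum>j\<in>UNIV. of_bool ((j, i) \<in> E) *\<^sub>R vec_tensor 1 h $ j) = real (in_deg E i) *\<^sub>R h" for i
    by (simp add: in_deg_def flip: scaleR_sum_left)
  moreover have "real (deg E i) *\<^sub>R h - 2 *\<^sub>R (real (in_deg E i) *\<^sub>R h) =
      degree_balance E $ i *\<^sub>R h" for i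
  proof -
    have "degree_balance E $ i = real (deg E i) - 2 * real (in_deg E i)"
      by (simp add: degree_balance_def deg_def)
    then show ?thesis by (simp add: scaleR_diff_left)
  qed
  ultimately show ?thesis by (simp add: vec_eq_iff mat_tensor_PG_nth[OF assms])
qed


section \<open>Factors of the Laplacian\<close>

locale laplacian_factor =
  fixes E :: "('n::finite \<times> 'n) set" and Z :: "real^'m^'n"
  assumes asym: "\<And>i j. (i, j) \<in> E \<Longrightarrow> (j, i) \<notin> E"
    and connected: "graph_connected E"
    and factor: "Lap E = Z ** transpose Z"
    and card: "CARD('m) = CARD('n) - 1"
begin

lemma kernel_transpose:
  fixes w :: "'h::real_inner^'n"
  shows "mat_tensor (transpose Z) w = 0 \<longleftrightarrow> w \<in> diagonal"
proof
  assume "mat_tensor (transpose Z) w = 0"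
  then have "mat_tensor (Lap E) w = 0" by (simp add: factor flip: mat_tensor_mult)
  then show "w \<in> diagonal" using Lap_kernel_diagonal asym connected by blast
next
  assume "w \<in> diagonal"
  then have "mat_tensor (Lap E) w = 0" using mat_tensor_Lap_diagonal asym by blast
  moreover have "mat_tensor (transpose Z) w \<bullet> mat_tensor (transpose Z) w = w \<bullet> mat_tensor (Lap E) w"
    by (simp add: factor inner_mat_tensor flip: mat_tensor_mult)
  ultimately show "mat_tensor (transpose Z) w = 0" by simp
qed

lemma range_orthogonal_diagonal:
  fixes v :: "'h::real_inner^'m"
  shows "mat_tensor Z v \<in> diagonal\<^sup>\<bottom>"
  by (simp add: orthogonal_comp_def orthogonal_def inner_mat_tensor kernel_transpose[THEN iffD2])

text \<open>
  The orthogonal complement of the range of \<open>Z\<close> is the kernel of \<open>Z\<^sup>*\<close>, which has dimension at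
  most \<open>1\<close>; so the rank of \<open>Z\<close> is at least \<open>n - 1\<close>, its number of columns.
\<close>

lemma injective: "inj ((*v) Z)"
proof -
  have "subspace (range ((*v) Z))"
    by (rule linear_subspace_image) auto
  then have dims: "dim {y \<in> UNIV. \<forall>x \<in> range ((*v) Z). orthogonal x y} + rank Z = CARD('n)"
    using dim_subspace_orthogonal_to_vectors[of "range ((*v) Z)" "UNIV :: (real^'n) set"]
    by (simp add: rank_dim_range)
  have "y \<in> span {1}" if y: "\<forall>x \<in> range ((*v) Z). orthogonal x y" for y :: "real^'n"
  proof -
    have "transpose Z *v y = 0"
    proof -
      have "(transpose Z *v y) \<bullet> (transpose Z *v y) = y \<bullet> (Z *v (transpose Z *v y))"
        by (metis dot_lmul_matrix transpose_matrix_vector)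
      also have "\<dots> = 0" using y by (simp add: orthogonal_def inner_commute)
      finally show ?thesis by simp
    qed
    then have "y \<in> diagonal" by (simp add: mat_tensor_real flip: kernel_transpose)
    then obtain c where "y = c *\<^sub>R 1"
      by (auto simp: diagonal_iff vec_eq_iff)
    then show ?thesis by (simp add: span_base span_scale)
  qed
  then have "dim {y \<in> UNIV. \<forall>x \<in> range ((*v) Z). orthogonal x y} \<le> card {1 :: real^'n}"
    by (intro dim_le_card) auto
  then have "rank Z = CARD('m)" using dims rank_bound[of Z] card by simp
  then show ?thesis by (simp add: full_rank_injective)
qed

lemma pinv_cancel: "mat_tensor (pinv Z) (mat_tensor Z v) = v"
  by (simp add: mat_tensor_mult pinv_injective(2)[OF injective])

text \<open>
  The residual of the projection \<open>Z Z\<^sup>\<dagger>\<close> lies in the kernel of \<open>Z\<^sup>*\<close>, which is the diagonal; if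
  \<open>y\<close> is orthogonal to the diagonal, then so is the residual, which therefore vanishes.
\<close>

lemma cancel_pinv:
  fixes y :: "'h::real_inner^'n"
  assumes y: "y \<in> diagonal\<^sup>\<bottom>"
  shows "mat_tensor Z (mat_tensor (pinv Z) y) = y"
proof -
  define r where "r = y - mat_tensor Z (mat_tensor (pinv Z) y)"
  have pinv: "transpose (Z ** pinv Z) = Z ** pinv Z" "Z ** pinv Z ** Z = Z"
    using pinv_injective(1)[OF injective] by (auto simp: is_pinv_def)
  have "transpose Z ** (Z ** pinv Z) = transpose (Z ** pinv Z ** Z)"
    by (simp only: matrix_transpose_mul[of "Z ** pinv Z"] pinv(1))
  then have "mat_tensor (transpose Z) r = 0"
    by (simp add: r_def mat_tensor_diff mat_tensor_mult pinv(2))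
  then have "r \<in> diagonal" by (simp add: kernel_transpose)
  moreover have "r \<in> diagonal\<^sup>\<bottom>"
    unfolding r_def by (intro subspace_diff subspace_orthogonal_comp y range_orthogonal_diagonal)
  ultimately have "r \<bullet> r = 0" by (auto simp: orthogonal_comp_def orthogonal_def)
  then show ?thesis by (simp add: r_def)
qed

lemma pinv_image_iff:
  fixes v :: "'h::real_inner^'m"
  shows "v \<in> mat_tensor (pinv Z) ` (P \<inter> diagonal\<^sup>\<bottom>) \<longleftrightarrow> mat_tensor Z v \<in> P"
  using pinv_cancel[of v] range_orthogonal_diagonal[of v] by (force simp: cancel_pinv)

text \<open>
  Being an orthogonal complement, the set \<open>E\<close> of the theorem is a closed subspace, onto which one
  can project.
\<close>

lemma pinv_image_orthogonal_comp:
  fixes S :: "('h::real_inner^'n) set"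
  shows "mat_tensor (pinv Z) ` (S\<^sup>\<bottom> \<inter> diagonal\<^sup>\<bottom>) = (mat_tensor (transpose Z) ` S)\<^sup>\<bottom>"
  by (intro set_eqI)
    (simp add: pinv_image_iff, simp add: orthogonal_comp_def orthogonal_def inner_mat_tensor)

text \<open>This is \<open>\<M> = \<C> \<C>\<^sup>*\<close>, since \<open>\<C>\<^sup>* (w, v) = Z\<^sup>* w + v\<close>.\<close>

lemma inner_M_op:
  fixes x :: "('h::real_inner^'n) \<times> ('h^'m)"
  shows "x \<bullet> M_op E Z x =
    (mat_tensor (transpose Z) (fst x) + snd x) \<bullet> (mat_tensor (transpose Z) (fst x) + snd x)"
proof (cases x)
  case (Pair w v)
  then show ?thesis
    by (simp add: M_op_def factor inner_mat_tensor[of w Z] inner_add_left inner_add_right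
        inner_commute flip: mat_tensor_mult)
qed

end

lemma adjoint_C_op:
  "adjoint (C_op Z) = (\<lambda>u :: ('h::real_inner^'n) \<times> ('h^'m). mat_tensor (transpose Z) (fst u) + snd u)"
proof (rule adjoint_unique, intro allI)
  fix x :: "'h^'m" and u :: "('h^'n) \<times> ('h^'m)"
  show "C_op Z x \<bullet> u = x \<bullet> (mat_tensor (transpose Z) (fst u) + snd u)"
    by (cases u) (simp add: C_op_def inner_mat_tensor inner_add_right)
qed


section \<open>Fixed points\<close>

text \<open>
  In \<open>\<M> + \<A>\<close> the Laplacian and \<open>Z v\<close> cancel, which leaves \<open>\<A>\<^sub>D + P(G)\<close> acting on \<open>w\<close>, and
  \<open>v\<close> is determined by \<open>w\<close>.  As \<open>P(G)\<close> is triangular with positive diagonal, \<open>w\<close> is found by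
  forward substitution.  At the first node \<open>i\<close> where two solutions could differ, the difference
  lies in \<open>U\<^sub>i\<close> and a positive multiple of it in \<open>U\<^sub>i\<^sup>\<bottom>\<close>, so it is zero.
\<close>

lemma resolvent_single_valued:
  fixes U :: "'n::{finite,linorder} \<Rightarrow> 'h::real_inner set"
  assumes U: "\<And>i. subspace (U i)" and A: "\<And>i. A i = normal_cone_subspace (U i)"
    and G: "algorithmic_graph G"
    and y: "y \<in> A_op A G E' Z x" "y' \<in> A_op A G E' Z x'"
    and eq: "M_op E' Z x + y = M_op E' Z x' + y'"
  shows "x = x'"
proof -
  have less: "\<And>i j. (i, j) \<in> G \<Longrightarrow> i < j" using G by (auto simp: algorithmic_graph_def)
  then have irrefl: "\<And>i. (i, i) \<notin> G" by fastforce
  obtain w v w' v' where x: "x = (w, v)" "x' = (w', v')" by fastforce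
  obtain a a' where a: "a \<in> A_D A w" "a' \<in> A_D A w'"
    and y_eq: "y = (a + mat_tensor (PG G) w - mat_tensor (Lap E') w - mat_tensor Z v,
        mat_tensor (transpose Z) w)"
      "y' = (a' + mat_tensor (PG G) w' - mat_tensor (Lap E') w' - mat_tensor Z v',
        mat_tensor (transpose Z) w')"
    using y by (auto simp: A_op_def x)
  have eq1: "a + mat_tensor (PG G) w = a' + mat_tensor (PG G) w'"
    and eq2: "mat_tensor (transpose Z) w + v + mat_tensor (transpose Z) w =
      mat_tensor (transpose Z) w' + v' + mat_tensor (transpose Z) w'"
    using eq by (simp_all add: x y_eq M_op_def)
  have mem: "w $ i \<in> U i" "w' $ i \<in> U i" "a $ i \<in> (U i)\<^sup>\<bottom>" "a' $ i \<in> (U i)\<^sup>\<bottom>" for i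
    using a by (auto simp: A_D_def prod_set_def A normal_cone_subspace_def split: if_splits)
  define e where "e = w - w'"
  have "e = 0"
  proof (rule ccontr)
    assume "e \<noteq> 0"
    then have ne: "{i. e $ i \<noteq> 0} \<noteq> {}" by (auto simp: vec_eq_iff)
    define i where "i = Min {i. e $ i \<noteq> 0}"
    have i: "e $ i \<noteq> 0" using Min_in[OF _ ne] by (simp add: i_def)
    have below: "e $ j = 0" if "j < i" for j
    proof (rule ccontr)
      assume "e $ j \<noteq> 0"
      then have "i \<le> j" unfolding i_def by (intro Min_le) auto
      then show False using that by simp
    qed
    have "mat_tensor (PG G) e = a' - a"
      using eq1 by (simp add: e_def mat_tensor_diff algebra_simps)
    then have "mat_tensor (PG G) e $ i = a' $ i - a $ i" by simp
    moreover have "(\<Sum>j\<in>UNIV. of_bool ((j, i) \<in> G) *\<^sub>R e $ j) = 0"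
      using less below by (intro sum.neutral) auto
    ultimately have d: "real (deg G i) *\<^sub>R e $ i = a' $ i - a $ i"
      by (simp add: mat_tensor_PG_nth[OF irrefl])
    have "e $ i \<in> U i" using U mem by (simp add: e_def subspace_diff)
    moreover have "a' $ i - a $ i \<in> (U i)\<^sup>\<bottom>"
      using mem by (intro subspace_diff subspace_orthogonal_comp)
    ultimately have "e $ i \<bullet> (real (deg G i) *\<^sub>R e $ i) = 0"
      unfolding d by (simp add: orthogonal_comp_def orthogonal_def)
    then show False using deg_pos[OF G, of i] i by simp
  qed
  then have "w = w'" by (simp add: e_def)
  then show ?thesis using eq2 by (simp add: x)
qed

lemma Fix_T_op_eq_zeros:
  fixes U :: "'n::{finite,linorder} \<Rightarrow> 'h::real_inner set"
  assumes "\<And>i. subspace (U i)" and "\<And>i. A i = normal_cone_subspace (U i)"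
    and "algorithmic_graph G"
  shows "Fix (T_op A G E' Z) = {x. 0 \<in> A_op A G E' Z x}"
proof (intro set_eqI iffI)
  fix x assume "x \<in> Fix (T_op A G E' Z)"
  then have "x \<in> T_op A G E' Z x" by (simp add: Fix_def)
  then show "x \<in> {x. 0 \<in> A_op A G E' Z x}"
    by (auto simp: T_op_def op_inverse_def)
next
  fix x assume x: "x \<in> {x. 0 \<in> A_op A G E' Z x}"
  have "x' \<in> T_op A G E' Z x \<longleftrightarrow> x' = x" for x'
  proof
    assume "x' \<in> T_op A G E' Z x"
    then obtain y where "y \<in> A_op A G E' Z x'" "M_op E' Z x' + y = M_op E' Z x + 0"
      by (auto simp: T_op_def op_inverse_def)
    then show "x' = x" using resolvent_single_valued[where U = U and A = A, OF assms] x by blast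
  next
    assume "x' = x"
    then show "x' \<in> T_op A G E' Z x"
      using x by (auto simp: T_op_def op_inverse_def intro!: exI[of _ 0]
          simp del: split_paired_Ex)
  qed
  then have "T_op A G E' Z x = {x}" by blast
  then show "x \<in> Fix (T_op A G E' Z)" by (simp add: Fix_def)
qed

text \<open>
  The second component of \<open>0 \<in> \<A> (w, v)\<close> forces \<open>w\<close> to be constant, with a value \<open>h\<close> in every
  \<open>U\<^sub>i\<close>.  The first component then says that \<open>Z v - \<delta> h = Z (v - \<alpha> h)\<close> is a normal vector, where
  \<open>\<delta> = Z \<alpha>\<close> because \<open>\<delta>\<close> has entry sum zero.
\<close>

lemma (in laplacian_factor) zeros_A_op:
  fixes U :: "'n \<Rightarrow> 'h::real_inner set"
  assumes U: "\<And>i. subspace (U i)" and A: "\<And>i. A i = normal_cone_subspace (U i)"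
    and irrefl: "\<And>i. (i, i) \<notin> G"
  shows "{x. 0 \<in> A_op A G E Z x} =
    {(vec_tensor 1 h, vec_tensor (pinv Z *v degree_balance G) h + e) | h e.
      h \<in> (\<Inter>i. U i) \<and> e \<in> mat_tensor (pinv Z) ` ((prod_set U)\<^sup>\<bottom> \<inter> diagonal\<^sup>\<bottom>)}"
    (is "?L = ?R")
proof -
  let ?\<alpha> = "pinv Z *v degree_balance G"
  have perp: "(prod_set U)\<^sup>\<bottom> = prod_set (\<lambda>i. (U i)\<^sup>\<bottom>)"
    using U by (intro orthogonal_comp_prod_set subspace_0)
  have Z\<alpha>: "mat_tensor Z (vec_tensor ?\<alpha> h) = vec_tensor (degree_balance G) h" for h :: 'h
    using cancel_pinv[OF degree_balance_orthogonal_diagonal]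
    by (simp add: mat_tensor_vec_tensor)
  have Lap0: "mat_tensor (Lap E) (vec_tensor 1 h) = 0" for h :: 'h
    using mat_tensor_Lap_diagonal[OF asym] by (auto simp: diagonal_iff)
  have A_D: "a \<in> A_D A (vec_tensor 1 h) \<longleftrightarrow> h \<in> (\<Inter>i. U i) \<and> a \<in> (prod_set U)\<^sup>\<bottom>" for a h
    unfolding perp by (auto simp: A_D_def prod_set_def A normal_cone_subspace_def split: if_splits)
  have zero: "0 \<in> A_op A G E Z (vec_tensor 1 h, v) \<longleftrightarrow>
      h \<in> (\<Inter>i. U i) \<and> mat_tensor Z (v - vec_tensor ?\<alpha> h) \<in> (prod_set U)\<^sup>\<bottom>" for h v
  proof -
    have "mat_tensor (transpose Z) (vec_tensor 1 h) = 0"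
      using kernel_transpose[of "vec_tensor 1 h"] by (auto simp: diagonal_iff)
    then have "0 \<in> A_op A G E Z (vec_tensor 1 h, v) \<longleftrightarrow>
        (\<exists>a \<in> A_D A (vec_tensor 1 h). a + vec_tensor (degree_balance G) h - mat_tensor Z v = 0)"
      by (auto simp: A_op_def Lap0 mat_tensor_PG_diagonal[OF irrefl] zero_prod_def)
    also have "\<dots> \<longleftrightarrow> mat_tensor Z v - vec_tensor (degree_balance G) h \<in> A_D A (vec_tensor 1 h)"
      by (auto simp: add_diff_eq eq_diff_eq[symmetric] diff_eq_eq)
    finally show ?thesis by (simp add: A_D mat_tensor_diff Z\<alpha>)
  qed
  show ?thesis
  proof (intro equalityI subsetI)
    fix x assume x: "x \<in> ?L"
    obtain w v where wv: "x = (w, v)" by fastforce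
    have "mat_tensor (transpose Z) w = 0"
      using x by (auto simp: wv A_op_def zero_prod_def)
    then obtain h where h: "w = vec_tensor 1 h"
      by (auto simp: kernel_transpose diagonal_iff)
    have *: "h \<in> (\<Inter>i. U i)"
        "v - vec_tensor ?\<alpha> h \<in> mat_tensor (pinv Z) ` ((prod_set U)\<^sup>\<bottom> \<inter> diagonal\<^sup>\<bottom>)"
      using x zero[of h v] by (auto simp: wv h pinv_image_iff simp del: INT_iff)
    then show "x \<in> ?R"
      unfolding wv h by (intro CollectI exI[of _ h] exI[of _ "v - vec_tensor ?\<alpha> h"]) simp
  next
    fix x assume "x \<in> ?R"
    then obtain h e where *: "x = (vec_tensor 1 h, vec_tensor ?\<alpha> h + e)" "h \<in> (\<Inter>i. U i)"
      "mat_tensor Z e \<in> (prod_set U)\<^sup>\<bottom>"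
      by (auto simp: pinv_image_iff)
    then show "x \<in> ?L" using zero[of h "vec_tensor ?\<alpha> h + e"] by simp
  qed
qed


section \<open>The projection onto the fixed points\<close>

theorem corollary4p6:
  fixes U :: "'n::{finite,linorder} \<Rightarrow> 'h::{real_inner,complete_space} set"
    and A :: "'n \<Rightarrow> 'h \<Rightarrow> 'h set"
    and G G' :: "('n \<times> 'n) set"
    and Z :: "real^'m^'n::{finite,linorder}"
    and \<alpha> :: "real^'m"
    and E :: "('h^'m) set"
    and T :: "('h^'n::{finite,linorder}) \<times> ('h^'m) \<Rightarrow> (('h^'n::{finite,linorder}) \<times> ('h^'m)) set"
    and u :: "('h^'n::{finite,linorder}) \<times> ('h^'m)"
  assumes U: "\<And>i. subspace (U i)" "\<And>i. closed (U i)"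
    and A: "\<And>i. A i = normal_cone_subspace (U i)"
    and G: "algorithmic_graph G"
    and G': "G' \<subseteq> G" "graph_connected G'"
    and m: "CARD('m) = CARD('n) - 1"
    and Z: "Lap G' = Z ** transpose Z"
    and T: "T = T_op A G G' Z"
    and \<alpha>: "\<alpha> = pinv Z *v degree_balance G"
    and E: "E = mat_tensor (pinv Z) ` ((prod_set U)\<^sup>\<bottom> \<inter> diagonal\<^sup>\<bottom>)"
  shows "op_proj (M_op G' Z) (Fix T) u =
    {(let p = orth_proj (\<Inter>i. U i) (vec_pinv_tensor \<alpha> (adjoint (C_op Z) u))
      in (vec_tensor 1 p, vec_tensor \<alpha> p))
     + (0, orth_proj E (adjoint (C_op Z) u))}"
proof -
  have asym: "(j, i) \<notin> G'" if "(i, j) \<in> G'" for i j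
    using that G G'(1) by (auto simp: algorithmic_graph_def) (meson less_asym subsetD)
  have irrefl: "(i, i) \<notin> G" for i
    using G by (force simp: algorithmic_graph_def)
  interpret laplacian_factor G' Z
    using asym G'(2) Z m by unfold_locales auto
  define UU where "UU = (\<Inter>i. U i)"
  have UU: "subspace UU" "closed UU"
    unfolding UU_def using U by (auto intro!: subspace_Int)
  have "E = (mat_tensor (transpose Z) ` prod_set U)\<^sup>\<bottom>"
    unfolding E by (rule pinv_image_orthogonal_comp)
  then have closed_E: "subspace E" "closed E"
    by (simp_all add: subspace_orthogonal_comp closed_orthogonal_comp)
  have Fix: "Fix T = {(vec_tensor 1 h, vec_tensor \<alpha> h + e) | h e. h \<in> UU \<and> e \<in> E}"
    unfolding T Fix_T_op_eq_zeros[where U = U and A = A, OF U(1) A G]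
      zeros_A_op[where U = U and A = A, OF U(1) A irrefl] \<alpha> E UU_def ..
  have "Z *v \<alpha> = degree_balance G"
    using cancel_pinv[OF degree_balance_orthogonal_diagonal[of G "1 :: real"]]
    by (simp add: \<alpha> mat_tensor_real vec_tensor_def)
  then have \<alpha>_nz: "\<alpha> \<noteq> 0" using degree_balance_nonzero[OF G] by auto
  \<comment> \<open>The transpose of \<open>Z\<^sup>\<dagger>\<close> turns \<open>\<alpha> h\<close> into some \<open>\<beta> h\<close>, whose entries are multiples of
    \<open>h \<in> U\<close>; so it lies in the product of the \<open>U\<^sub>i\<close> whatever \<open>\<beta>\<close> is.\<close>
  have orth: "e \<bullet> vec_tensor \<alpha> h = 0" if e: "e \<in> E" and h: "h \<in> UU" for e h
  proof -
    obtain y where y: "y \<in> (prod_set U)\<^sup>\<bottom>" "e = mat_tensor (pinv Z) y"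
      using e by (auto simp: E)
    have "vec_tensor \<beta> h \<in> prod_set U" for \<beta>
      using h U(1) by (auto simp: prod_set_def UU_def intro!: subspace_scale)
    then have "vec_tensor (transpose (pinv Z) *v \<alpha>) h \<bullet> y = 0"
      using y(1) unfolding orthogonal_comp_def orthogonal_def by blast
    then show ?thesis
      by (simp add: y(2) inner_commute[of _ "vec_tensor \<alpha> h"] inner_mat_tensor
          mat_tensor_vec_tensor del: transpose_matrix_vector)
  qed
  define L where "L = (\<lambda>x :: ('h^'n::{finite,linorder}) \<times> ('h^'m). mat_tensor (transpose Z) (fst x) + snd x)"
  define p where "p = orth_proj UU (vec_pinv_tensor \<alpha> (L u))"
  define q where "q = orth_proj E (L u)"
  have p: "p \<in> UU" "vec_pinv_tensor \<alpha> (L u) - p \<in> UU\<^sup>\<bottom>"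
    unfolding p_def by (rule orth_proj[OF UU])+
  have q: "q \<in> E" "L u - q \<in> E\<^sup>\<bottom>"
    unfolding q_def by (rule orth_proj[OF closed_E])+
  have L_Fix: "L (vec_tensor 1 h, v) = v" for h v
    using kernel_transpose[of "vec_tensor 1 h"] by (auto simp: L_def diagonal_iff)
  have "op_proj (M_op G' Z) (Fix T) u = {(vec_tensor 1 p, vec_tensor \<alpha> p + q)}"
  proof (rule op_proj_eqI[where L = L])
    show "x \<bullet> M_op G' Z x = L x \<bullet> L x" for x
      by (simp add: inner_M_op L_def)
    show "L (x - y) = L x - L y" for x y
      by (simp add: L_def mat_tensor_diff)
    show "(vec_tensor 1 p, vec_tensor \<alpha> p + q) \<in> Fix T"
      using p q by (auto simp: Fix)
    show "(L u - L (vec_tensor 1 p, vec_tensor \<alpha> p + q)) \<bullet>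
        (L (vec_tensor 1 p, vec_tensor \<alpha> p + q) - L t) = 0" if t_Fix: "t \<in> Fix T" for t
    proof -
      obtain h e where t: "t = (vec_tensor 1 h, vec_tensor \<alpha> h + e)" "h \<in> UU" "e \<in> E"
        using t_Fix by (auto simp: Fix)
      have ph: "p - h \<in> UU" using UU p t by (simp add: subspace_diff)
      have qe: "q - e \<in> E" using closed_E q t by (simp add: subspace_diff)
      have "(L u - vec_tensor \<alpha> p) \<bullet> vec_tensor \<alpha> (p - h) = 0"
        using p(2) ph vec_pinv_tensor_orthogonal[OF \<alpha>_nz, of "L u" p "p - h"]
        by (simp add: orthogonal_comp_def orthogonal_def inner_commute)
      moreover have "(L u - q) \<bullet> (q - e) = 0"
        using q(2) qe by (simp add: orthogonal_comp_def orthogonal_def inner_commute)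
      moreover have "q \<bullet> vec_tensor \<alpha> (p - h) = 0" "vec_tensor \<alpha> p \<bullet> (q - e) = 0"
        using orth[OF q(1) ph] orth[OF qe p(1)] by (simp_all add: inner_commute)
      moreover have "(L u - (vec_tensor \<alpha> p + q)) \<bullet> ((vec_tensor \<alpha> p + q) - (vec_tensor \<alpha> h + e)) =
          (L u - vec_tensor \<alpha> p) \<bullet> vec_tensor \<alpha> (p - h) - q \<bullet> vec_tensor \<alpha> (p - h)
          + (L u - q) \<bullet> (q - e) - vec_tensor \<alpha> p \<bullet> (q - e)"
        by (simp add: vec_tensor_diff inner_diff_left inner_diff_right inner_add_left inner_add_right)
      ultimately show ?thesis by (simp add: L_Fix t(1))
    qed
    \<comment> \<open>For fixed points with values \<open>g\<close>, \<open>h\<close> and equal images, \<open>\<alpha> (g - h)\<close> lies both in \<open>\<alpha> U\<close>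
      and in \<open>E\<close>, so it is orthogonal to itself.\<close>
    show "inj_on L (Fix T)"
    proof (rule inj_onI)
      fix s t assume st: "s \<in> Fix T" "t \<in> Fix T" and eq: "L s = L t"
      obtain g d where s: "s = (vec_tensor 1 g, vec_tensor \<alpha> g + d)" "g \<in> UU" "d \<in> E"
        using st(1) by (auto simp: Fix)
      obtain h e where t: "t = (vec_tensor 1 h, vec_tensor \<alpha> h + e)" "h \<in> UU" "e \<in> E"
        using st(2) by (auto simp: Fix)
      have *: "vec_tensor \<alpha> g + d = vec_tensor \<alpha> h + e" using eq by (simp add: s t L_Fix)
      then have "vec_tensor \<alpha> (g - h) = e - d"
        by (simp add: vec_tensor_diff algebra_simps)
      moreover have "(e - d) \<bullet> vec_tensor \<alpha> (g - h) = 0"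
        using s t UU closed_E by (intro orth) (auto intro: subspace_diff)
      ultimately have "vec_tensor \<alpha> (g - h) = 0" by simp
      then have "g = h" using \<alpha>_nz by (auto simp: vec_eq_iff)
      then show "s = t" using * by (simp add: s t)
    qed
  qed
  then show ?thesis
    by (simp add: Let_def adjoint_C_op p_def q_def L_def UU_def)
qed

end
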